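(* Let $X$ and $Y$ be normed lattices, with the norm on $Y$ strictly monotone, and let $S\colon X\to Y$ be an order-preserving isometry. Then $T:=S-S(0)$ preserves suprema and infima. Moreover, $T$ is disjointness preserving and disjointly additive. Furthermore, $T$ preserves all lattice operations if and only if $T$ is odd.
   Context: All vector spaces are real and nontrivial. Maps, including isometries, are not assumed linear, affine, or surjective unless stated. A *vector lattice* is a vector space with a partial order compatible with the linear structure ($x\le y$ implies $x+z\le y+z$ and $ax\le ay$ for real $a\ge 0$) in which every pair $x,y$ has a supremum $x\vee y$ and an infimum $x\wedge y$. Put $|x|:=x\vee(-x)$, $x^+:=x\vee 0$, $x^-:=(-x)\vee 0$. The five lattice operations are $|x|$, $x\wedge y$, $x\vee y$, $x^+$, $x^-$. Vectors $x,y$ are *disjoint*, written $x\perp y$, if $|x|\wedge|y|=0$. Write $x<y$ for $x\le y$ and $x\ne y$. A *normed lattice* is a vector lattice with a norm satisfying $|x|\le|y|\Rightarrow\|x\|\le\|y\|$ (completeness is not assumed). The norm is *strictly monotone* if $\|x\|<\|y\|$ whenever $|x|<|y|$. A map $S\colon X\to Y$ between normed spaces is an *isometry* if $\|S(x)-S(y)\|_Y=\|x-y\|_X$ for all $x,y\in X$. A map $T\colon X\to Y$ between vector lattices is: - *order-preserving* if $x\le y$ implies $T(x)\le T(y)$; - *preserving suprema and infima* if $T(x\vee y)=T(x)\vee T(y)$ and $T(x\wedge y)=T(x)\wedge T(y)$ for all $x,y\in X$; - *disjointness preserving* if $x\perp y$ implies $T(x)\perp T(y)$; - *disjointly additive*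 if $x\perp y$ implies $T(x+y)=T(x)+T(y)$; - *preserving all lattice operations* if it preserves suprema and infima and, for all $x\in X$, $T(|x|)=|T(x)|$, $T(x^+)=T(x)^+$, $T(x^-)=T(x)^-$; - *odd* if $T(-x)=-T(x)$ for all $x\in X$. The map $S-S(0)$ is $x\mapsto S(x)-S(0)$. *)

theory Defs
  imports "HOL-Library.Lattice_Algebras"
begin

text \<open>
  Compatibility of the order with addition and with scaling by nonnegative reals comes from
  \<^class>\<open>ordered_real_vector\<close>; its second scaling axiom is a consequence of the first.
  \<^class>\<open>lattice_ab_group_add_abs\<close> adds suprema and infima together with
  \<open>\<bar>x\<bar> = sup x (- x)\<close>.
\<close>

class vector_lattice = ordered_real_vector + lattice_ab_group_add_abs +
  assumes nontrivial: "\<exists>x. x \<noteq> 0"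

class normed_lattice = vector_lattice + real_normed_vector +
  assumes norm_abs_mono: "\<bar>x\<bar> \<le> \<bar>y\<bar> \<Longrightarrow> norm x \<le> norm y"

definition strictly_monotone_norm :: "'a::normed_lattice itself \<Rightarrow> bool"
  where "strictly_monotone_norm _ \<longleftrightarrow> (\<forall>x y :: 'a. \<bar>x\<bar> < \<bar>y\<bar> \<longrightarrow> norm x < norm y)"

text \<open>
  The positive part \<open>sup x 0\<close> is the library's \<^const>\<open>pprt\<close>. The library's \<^const>\<open>nprt\<close> is
  \<open>inf x 0\<close>, that is, minus the negative part used here.
\<close>

definition neg_part :: "'a::vector_lattice \<Rightarrow> 'a"
  where "neg_part x = sup (- x) 0"

definition lattice_disjoint :: "'a::vector_lattice \<Rightarrow> 'a \<Rightarrow> bool"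
  where "lattice_disjoint x y \<longleftrightarrow> inf \<bar>x\<bar> \<bar>y\<bar> = 0"

definition isometry :: "('a::real_normed_vector \<Rightarrow> 'b::real_normed_vector) \<Rightarrow> bool"
  where "isometry S \<longleftrightarrow> (\<forall>x y. norm (S x - S y) = norm (x - y))"

definition preserves_sup_inf :: "('a::vector_lattice \<Rightarrow> 'b::vector_lattice) \<Rightarrow> bool"
  where "preserves_sup_inf T \<longleftrightarrow>
    (\<forall>x y. T (sup x y) = sup (T x) (T y) \<and> T (inf x y) = inf (T x) (T y))"

definition disjointness_preserving :: "('a::vector_lattice \<Rightarrow> 'b::vector_lattice) \<Rightarrow> bool"
  where "disjointness_preserving T \<longleftrightarrow>
    (\<forall>x y. lattice_disjoint x y \<longrightarrow> lattice_disjoint (T x) (T y))"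

definition disjointly_additive :: "('a::vector_lattice \<Rightarrow> 'b::vector_lattice) \<Rightarrow> bool"
  where "disjointly_additive T \<longleftrightarrow>
    (\<forall>x y. lattice_disjoint x y \<longrightarrow> T (x + y) = T x + T y)"

definition preserves_all_lattice_operations ::
    "('a::vector_lattice \<Rightarrow> 'b::vector_lattice) \<Rightarrow> bool"
  where "preserves_all_lattice_operations T \<longleftrightarrow> preserves_sup_inf T \<and>
    (\<forall>x. T \<bar>x\<bar> = \<bar>T x\<bar> \<and> T (pprt x) = pprt (T x) \<and> T (neg_part x) = neg_part (T x))"

definition odd_map :: "('a::vector_lattice \<Rightarrow> 'b::vector_lattice) \<Rightarrow> bool"
  where "odd_map T \<longleftrightarrow> (\<forall>x. T (- x) = - T x)"

end

theory Submission
  imports Defs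
begin

text \<open>
  Since \<open>\<bar>T x - T y\<bar> = sup (T x) (T y) - inf (T x) (T y)\<close> lies below
  \<open>T (sup x y) - T (inf x y)\<close> and the two have the same norm, strict monotonicity forces them
  to coincide, which gives preservation of suprema and infima. With \<open>T 0 = 0\<close> it follows that
  \<open>T\<close> commutes with \<open>sup _ 0\<close> and \<open>inf _ 0\<close>, so that \<open>T p\<close> and \<open>- T (- q)\<close> are the positive
  and negative parts of \<open>T (p - q)\<close> for disjoint positive \<open>p\<close> and \<open>q\<close>. Decomposing into positive
  and negative parts yields the statements on disjointness.
\<close>

section \<open>Disjointness in lattice-ordered groups\<close>

text \<open>A lower bound \<open>d\<close> of \<open>a\<close> and \<open>b + c\<close> satisfies
  \<open>d - b \<le> inf a c = 0\<close>, because \<open>0 \<le> b\<close>; hence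
  \<open>d \<le> inf a b = 0\<close>.\<close>

lemma inf_add_eq_0:
  fixes a b c :: "'a::lattice_ab_group_add"
  assumes "inf a b = 0" "inf a c = 0"
  shows "inf a (b + c) = 0"
proof (rule antisym)
  define d where "d = inf a (b + c)"
  have nonneg: "0 \<le> a" "0 \<le> b" "0 \<le> c"
    using assms by (metis inf_le1 inf_le2)+
  have d: "d \<le> a" "d \<le> b + c"
    by (simp_all add: d_def)
  have "d - b \<le> c"
    using d(2) by (simp add: algebra_simps)
  moreover have "d - b \<le> a"
    using add_mono[OF d(1) nonneg(2)] by (simp add: algebra_simps)
  ultimately have "d - b \<le> inf a c"
    by simp
  then have "d \<le> b"
    by (simp add: assms)
  with d(1) have "d \<le> inf a b"
    by simp
  then show "inf a (b + c) \<le> 0"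
    by (simp add: assms d_def)
  show "0 \<le> inf a (b + c)"
    using nonneg by simp
qed

lemma inf_add_add_eq_0:
  fixes a b c d :: "'a::lattice_ab_group_add"
  assumes "inf a c = 0" "inf a d = 0" "inf b c = 0" "inf b d = 0"
  shows "inf (a + b) (c + d) = 0"
  using assms by (metis inf_add_eq_0 inf.commute)

lemma sup_eq_add_if_inf_eq_0:
  fixes a b :: "'a::lattice_ab_group_add"
  assumes "inf a b = 0"
  shows "sup a b = a + b"
  using add_eq_inf_sup[of a b] assms by simp

lemma inf_eq_add_if_sup_eq_0:
  fixes a b :: "'a::lattice_ab_group_add"
  assumes "sup a b = 0"
  shows "inf a b = a + b"
  using add_eq_inf_sup[of a b] assms by simp

text \<open>Translating \<open>inf x 0\<close> by \<open>- nprt x\<close> turns its arguments into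
  \<open>pprt x\<close> and \<open>- nprt x\<close>, and its value into 0.\<close>

lemma inf_pprt_uminus_nprt:
  fixes x :: "'a::lattice_ab_group_add"
  shows "inf (pprt x) (- nprt x) = 0"
proof -
  have "inf (pprt x) (- nprt x) = inf x 0 - nprt x"
    using add_inf_distrib_right[of x 0 "- nprt x"] prts[of x]
    by (metis add.left_neutral add_diff_cancel_right' diff_conv_add_uminus)
  then show ?thesis
    by (simp add: nprt_def)
qed

lemma pprt_diff_eq:
  fixes p q :: "'a::lattice_ab_group_add"
  assumes "inf p q = 0"
  shows "pprt (p - q) = p"
proof -
  have "pprt (p - q) = sup p q - q"
    using add_sup_distrib_right[of p q "- q"] by (simp add: pprt_def)
  then show ?thesis
    by (simp add: sup_eq_add_if_inf_eq_0[OF assms])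
qed

lemma nprt_diff_eq:
  fixes p q :: "'a::lattice_ab_group_add"
  assumes "inf p q = 0"
  shows "nprt (p - q) = - q"
  using prts[of "p - q"] pprt_diff_eq[OF assms]
  by (simp add: eq_neg_iff_add_eq_0 algebra_simps)

lemma abs_diff_eq_sup_diff_inf:
  fixes x y :: "'a::lattice_ab_group_add_abs"
  shows "\<bar>x - y\<bar> = sup x y - inf x y"
proof -
  have "pprt (x - y) = sup x y - y"
    using add_sup_distrib_right[of x y "- y"] by (simp add: pprt_def)
  moreover have "nprt (x - y) = inf x y - y"
    using add_inf_distrib_right[of x y "- y"] by (simp add: nprt_def)
  ultimately show ?thesis
    by (simp add: abs_prts)
qed

text \<open>Both parts lie below the modulus and add up to it, so disjointness reduces to four meets
  of positive elements.\<close>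

lemma lattice_disjoint_iff:
  "lattice_disjoint x y \<longleftrightarrow>
    inf (pprt x) (pprt y) = 0 \<and> inf (pprt x) (- nprt y) = 0 \<and>
    inf (- nprt x) (pprt y) = 0 \<and> inf (- nprt x) (- nprt y) = 0" (is "_ \<longleftrightarrow> ?parts")
proof
  assume "lattice_disjoint x y"
  then have disj: "inf \<bar>x\<bar> \<bar>y\<bar> = 0"
    by (simp add: lattice_disjoint_def)
  have le: "pprt z \<le> \<bar>z\<bar>" "- nprt z \<le> \<bar>z\<bar>" for z :: 'a
    by (simp_all add: abs_prts)
  have "inf a b = 0" if "0 \<le> a" "0 \<le> b" "a \<le> \<bar>x\<bar>" "b \<le> \<bar>y\<bar>" for a b
    using inf_mono[OF that(3,4)] that(1,2) disj by (simp add: antisym)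
  then show ?parts
    using le by simp
next
  assume ?parts
  then show "lattice_disjoint x y"
    using inf_add_add_eq_0[of "pprt x" "pprt y" "- nprt y" "- nprt x"]
    by (simp add: lattice_disjoint_def abs_prts)
qed

lemma norm_abs_eq:
  fixes x :: "'a::normed_lattice"
  shows "norm \<bar>x\<bar> = norm x"
  by (simp add: antisym norm_abs_mono)

section \<open>Order-preserving isometries\<close>

lemma mono_isometry_preserves_sup_inf:
  fixes T :: "'a::normed_lattice \<Rightarrow> 'b::normed_lattice"
  assumes strict: "strictly_monotone_norm TYPE('b)"
    and "mono T" and "isometry T"
  shows "preserves_sup_inf T"
  unfolding preserves_sup_inf_def
proof (intro allI)
  fix x y
  define s i where "s = T (sup x y)" and "i = T (inf x y)"
  have s: "sup (T x) (T y) \<le> s" and i: "i \<le> inf (T x) (T y)"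
    using \<open>mono T\<close> by (auto simp: s_def i_def mono_def)
  have le: "\<bar>T x - T y\<bar> \<le> s - i"
    unfolding abs_diff_eq_sup_diff_inf by (intro diff_mono s i)
  \<comment> \<open>Strict monotonicity compares moduli, so \<open>s - i\<close> has to be its own
    modulus.\<close>
  then have abs: "\<bar>s - i\<bar> = s - i"
    by (meson abs_ge_zero abs_of_nonneg order_trans)
  have "norm (s - i) = norm (sup x y - inf x y)"
    using \<open>isometry T\<close> by (simp add: isometry_def s_def i_def)
  also have "\<dots> = norm (T x - T y)"
    using \<open>isometry T\<close> abs_diff_eq_sup_diff_inf[of x y] norm_abs_eq[of "x - y"]
    by (simp add: isometry_def)
  finally have "\<not> \<bar>T x - T y\<bar> < \<bar>s - i\<bar>"
    using strict by (force simp: strictly_monotone_norm_def)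
  with le abs have "s - i = sup (T x) (T y) - inf (T x) (T y)"
    by (simp add: order.order_iff_strict abs_diff_eq_sup_diff_inf)
  moreover have "s - a = i - b" if "s - i = a - b" for a b
    using that by (simp add: algebra_simps)
  ultimately have "s - sup (T x) (T y) = i - inf (T x) (T y)"
    by blast
  \<comment> \<open>The two equal differences have opposite signs, so both vanish.\<close>
  moreover have "0 \<le> s - sup (T x) (T y)" "i - inf (T x) (T y) \<le> 0"
    using s i unfolding diff_ge_0_iff_ge diff_le_0_iff_le by blast+
  ultimately have "s - sup (T x) (T y) = 0" "i - inf (T x) (T y) = 0"
    by (metis antisym)+
  then show "T (sup x y) = sup (T x) (T y) \<and> T (inf x y) = inf (T x) (T y)"
    unfolding right_minus_eq s_def i_def by blast
qed

section \<open>Lattice homomorphisms fixing 0\<close>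

context
  fixes T :: "'a::vector_lattice \<Rightarrow> 'b::vector_lattice"
  assumes pres: "preserves_sup_inf T" and zero: "T 0 = 0"
begin

lemma map_sup: "T (sup x y) = sup (T x) (T y)"
  and map_inf: "T (inf x y) = inf (T x) (T y)"
  using pres by (simp_all add: preserves_sup_inf_def)

lemma map_pprt: "T (pprt x) = pprt (T x)"
  and map_nprt: "T (nprt x) = nprt (T x)"
  by (simp_all add: pprt_def nprt_def map_sup map_inf zero)

text \<open>\<open>T\<close> maps \<open>p\<close> and \<open>- q\<close>, the two parts of
  \<open>p - q\<close>, to the parts of \<open>T (p - q)\<close>. The term \<open>T (- q)\<close>
  stays as it is, since \<open>T\<close> need not be odd.\<close>

lemma map_diff_if_inf_eq_0:
  assumes "inf p q = 0"
  shows "T (p - q) = T p + T (- q)"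
  using prts[of "T (p - q)"]
  by (simp add: map_pprt[symmetric] map_nprt[symmetric] pprt_diff_eq nprt_diff_eq assms)

lemma inf_map_uminus_map_uminus_eq_0:
  assumes "inf p q = 0"
  shows "inf (T p) (- T (- q)) = 0"
  using inf_pprt_uminus_nprt[of "T (p - q)"]
  by (simp add: map_pprt[symmetric] map_nprt[symmetric] pprt_diff_eq nprt_diff_eq assms)

lemma map_add_if_inf_eq_0:
  assumes "inf p q = 0"
  shows "T (p + q) = T p + T q"
proof -
  have "inf (T p) (T q) = 0"
    by (simp add: map_inf[symmetric] assms zero)
  then show ?thesis
    by (simp add: sup_eq_add_if_inf_eq_0[symmetric] map_sup assms)
qed

text \<open>Without oddness this does not follow from the positive case by negation. Dually,
  elements with supremum 0 add up to their infimum.\<close>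

lemma map_uminus_add_uminus_if_inf_eq_0:
  assumes "inf p q = 0"
  shows "T (- p + - q) = T (- p) + T (- q)"
proof -
  have sup0: "sup (- p) (- q) = 0"
    using assms by (simp add: neg_inf_eq_sup[symmetric])
  then have "sup (T (- p)) (T (- q)) = 0"
    by (simp add: map_sup[symmetric] zero)
  then show ?thesis
    using inf_eq_add_if_sup_eq_0[OF sup0] inf_eq_add_if_sup_eq_0 map_inf by metis
qed

lemma disjointness_preserving_if_preserves_sup_inf: "disjointness_preserving T"
  unfolding disjointness_preserving_def
proof (intro allI impI)
  fix x y :: 'a
  assume "lattice_disjoint x y"
  \<comment> \<open>The last condition is a supremum of unnegated parts, because \<open>T\<close>
    commutes with \<open>sup\<close> but perhaps not with negation.\<close>
  then have d: "inf (pprt x) (pprt y) = 0" "inf (pprt x) (- nprt y) = 0"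
    "inf (pprt y) (- nprt x) = 0" "sup (nprt x) (nprt y) = 0"
    by (auto simp: lattice_disjoint_iff inf.commute sup_eq_neg_inf[of "nprt x"])
  have "inf (T (pprt x)) (T (pprt y)) = 0" "sup (T (nprt x)) (T (nprt y)) = 0"
    by (simp_all add: map_inf[symmetric] map_sup[symmetric] d zero)
  with inf_map_uminus_map_uminus_eq_0[OF d(2)]
    inf_map_uminus_map_uminus_eq_0[OF d(3)]
  show "lattice_disjoint (T x) (T y)"
    by (simp add: lattice_disjoint_iff map_pprt map_nprt inf.commute
        inf_eq_neg_sup[of "- nprt (T x)"])
qed

lemma disjointly_additive_if_preserves_sup_inf: "disjointly_additive T"
  unfolding disjointly_additive_def
proof (intro allI impI)
  fix x y :: 'a
  assume "lattice_disjoint x y"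
  then have d: "inf (pprt x) (pprt y) = 0" "inf (pprt x) (- nprt y) = 0"
    "inf (pprt y) (- nprt x) = 0" "inf (- nprt x) (- nprt y) = 0"
    by (auto simp: lattice_disjoint_iff inf.commute)
  \<comment> \<open>This writes \<open>x + y\<close> as a difference of disjoint elements, one
    collecting the positive parts and one the negative parts.\<close>
  have "inf (pprt x + pprt y) (- nprt x + - nprt y) = 0"
    by (intro inf_add_add_eq_0 inf_pprt_uminus_nprt d)
  from map_diff_if_inf_eq_0[OF this]
  have "T (pprt x + pprt y - (- nprt x + - nprt y))
      = T (pprt x + pprt y) + T (nprt x + nprt y)"
    by (simp add: algebra_simps)
  also have "pprt x + pprt y - (- nprt x + - nprt y) = (pprt x + nprt x) + (pprt y + nprt y)"
    by (simp add: algebra_simps)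
  also have "\<dots> = x + y"
    by (simp add: prts[symmetric])
  also have "T (pprt x + pprt y) = T (pprt x) + T (pprt y)"
    by (rule map_add_if_inf_eq_0[OF d(1)])
  also have "T (nprt x + nprt y) = T (nprt x) + T (nprt y)"
    using map_uminus_add_uminus_if_inf_eq_0[OF d(4)] by simp
  also have "T (pprt x) + T (pprt y) + (T (nprt x) + T (nprt y))
      = (pprt (T x) + nprt (T x)) + (pprt (T y) + nprt (T y))"
    by (simp add: map_pprt map_nprt algebra_simps)
  also have "\<dots> = T x + T y"
    by (simp add: prts[symmetric])
  finally show "T (x + y) = T x + T y" .
qed

lemma preserves_all_lattice_operations_iff_odd:
  "preserves_all_lattice_operations T \<longleftrightarrow> odd_map T"
proof
  assume all: "preserves_all_lattice_operations T"
  show "odd_map T"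
    unfolding odd_map_def
  proof
    fix x
    \<comment> \<open>The type \<open>'c\<close> is fresh because the identity is needed in both the
      domain and the codomain.\<close>
    have neg: "neg_part z = - nprt z" for z :: "'c::vector_lattice"
      by (simp add: neg_part_def nprt_def neg_inf_eq_sup)
    have "T (- nprt z) = - nprt (T z)" for z
      using all by (simp add: preserves_all_lattice_operations_def neg[symmetric])
    \<comment> \<open>Since \<open>- nprt x = pprt (- x)\<close> and
      \<open>- nprt (- x) = pprt x\<close>, the two instances determine both parts of
      \<open>T (- x)\<close>.\<close>
    from this[of x] this[of "- x"]
    have "pprt (T (- x)) = - nprt (T x)" "nprt (T (- x)) = - pprt (T x)"
      by (simp_all add: map_pprt[symmetric] nprt_neg pprt_neg)
    then show "T (- x) = - T x"
      by (metis add.commute minus_add_distrib prts)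
  qed
next
  assume "odd_map T"
  then show "preserves_all_lattice_operations T"
    \<comment> \<open>The modulus and the negative part are suprema involving \<open>- x\<close>,
      which oddness moves through \<open>T\<close>.\<close>
    by (simp add: preserves_all_lattice_operations_def odd_map_def pres map_pprt
        neg_part_def map_sup zero abs_lattice)
qed

end

theorem theorem1p6:
  fixes S T :: "'a::normed_lattice \<Rightarrow> 'b::normed_lattice"
  assumes "strictly_monotone_norm TYPE('b)"
    and "mono S"
    and "isometry S"
    and T_def: "T = (\<lambda>x. S x - S 0)"
  shows "preserves_sup_inf T
    \<and> disjointness_preserving T
    \<and> disjointly_additive T
    \<and> (preserves_all_lattice_operations T \<longleftrightarrow> odd_map T)"
proof -
  have "mono T" "isometry T" and zero: "T 0 = 0"
    using assms(2,3) by (simp_all add: T_def mono_def isometry_def)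
  then have pres: "preserves_sup_inf T"
    by (intro mono_isometry_preserves_sup_inf assms(1))
  then show ?thesis
    using zero by (simp add: disjointness_preserving_if_preserves_sup_inf
        disjointly_additive_if_preserves_sup_inf preserves_all_lattice_operations_iff_odd)
qed

end
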